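(* Let $\mathcal{H}$ be a real Hilbert space, let $l:\mathcal{H}\to\mathbb{R}$ and $r:\mathcal{H}\to\left]-\infty,+\infty\right]$ be proper, lower semicontinuous and convex, and let $f=l+r$. Assume that $\mathcal{X}=\{z\in\mathcal{H}: f(z)=\min_{x\in\mathcal{H}} f(x)\}$ is nonempty and put $f_*=\min_{x\in\mathcal{H}} f(x)$. Let $\alpha\in\left]0,+\infty\right[$, $\theta\in\left]0,1\right[$, and $\alpha_t=\alpha\,t^{-\theta}$ for every $t\in\mathbb{N}^*$. Let $\epsilon\in\left]0,+\infty\right[$ and let $\{\epsilon_t\}_{t\in\mathbb{N}^*}\subset\left[0,+\infty\right[$ satisfy $\epsilon_t\leq\epsilon\,\alpha_t$ for every $t\in\mathbb{N}^*$. Let $x_1\in\mathcal{H}$ and let $\{x_t\}_{t\in\mathbb{N}^*}$ be generated by $$x_{t+1}=\operatorname{prox}_{\alpha_t r}(x_t-\alpha_t g_t)\quad\text{with } g_t\in\partial_{\epsilon_t}l(x_t),\qquad t\in\mathbb{N}^*.$$ Assume that there exists $B\in\left]0,+\infty\right[$ such that, for every $t\in\mathbb{N}^*$ and every $g\in\partial_{\epsilon_t}l(x_t)\cup\partial r(x_t)$, $\|g\|\leq B$. Let $T\in\mathbb{N}$, $T>3$. Then $$f(x_T)-f_*\;\leq\;\frac{d(x_1,\mathcal{X})^2}{2\alpha}\,T^{\theta-1}+\alpha\,(5B^2+\epsilon)\,c_{2\theta}\,(\log T)^{\mathbf{1}_{\{2\theta\leq1\}}}\,T^{-\min\{\theta,1-\theta\}}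 .$$
   Context: $\mathbb{N}^*=\mathbb{N}\setminus\{0\}$; $d(x,S)=\inf_{x'\in S}\|x-x'\|$; $\log$ is the natural logarithm; $\mathbf{1}_{\{2\theta\leq1\}}$ equals $1$ if $2\theta\leq 1$ and $0$ otherwise. For convex $h:\mathcal{H}\to\left]-\infty,+\infty\right]$ and $\varepsilon\geq0$, $\partial_\varepsilon h(x)=\{u\in\mathcal{H}: \forall y\in\mathcal{H},\ h(x)+\langle u,y-x\rangle-\varepsilon\leq h(y)\}$, and $\partial h=\partial_0 h$. For $h$ proper, lower semicontinuous and convex, $\operatorname{prox}_h(x)=\operatorname{argmin}_{y\in\mathcal{H}}\{h(y)+\tfrac12\|y-x\|^2\}$. The constant is $c_q=5+\frac{2}{1-q}$ if $0\le q<1$, $c_q=9$ if $q=1$, and $c_q=\frac{2^q+3q-1}{q-1}$ if $q>1$. *)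

theory Defs
  imports "HOL-Analysis.Analysis"
begin

text \<open>
  Functions \<open>\<H> \<rightarrow> ]-\<infinity>, +\<infinity>]\<close> are rendered as functions into \<^typ>\<open>ereal\<close>;
  the exclusion of \<open>-\<infinity>\<close> is part of properness.
\<close>

definition proper_fun :: "('a \<Rightarrow> ereal) \<Rightarrow> bool" where
  "proper_fun h \<longleftrightarrow> (\<forall>x. h x \<noteq> -\<infinity>) \<and> (\<exists>x. h x \<noteq> \<infinity>)"

definition lsc_fun :: "('a::topological_space \<Rightarrow> ereal) \<Rightarrow> bool" where
  "lsc_fun h \<longleftrightarrow> (\<forall>x. h x \<le> Liminf (nhds x) h)"

text \<open>
  \<^const>\<open>convex_on\<close> is restricted to real-valued functions, so Jensen's inequality is
  restated here. In \<^typ>\<open>ereal\<close> one has \<open>0 * \<infinity> = 0\<close>, which makes the cases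
  \<open>u = 0\<close> and \<open>v = 0\<close> trivial, as they should be.
\<close>

definition convex_fun :: "('a::real_vector \<Rightarrow> ereal) \<Rightarrow> bool" where
  "convex_fun h \<longleftrightarrow>
     (\<forall>x y. \<forall>u\<ge>0. \<forall>v\<ge>0. u + v = 1 \<longrightarrow>
        h (u *\<^sub>R x + v *\<^sub>R y) \<le> ereal u * h x + ereal v * h y)"

lemma convex_fun_ereal_iff: "convex_fun (\<lambda>x. ereal (l x)) \<longleftrightarrow> convex_on UNIV l"
  by (simp add: convex_fun_def convex_on_def)

definition eps_subdiff :: "real \<Rightarrow> ('a::real_inner \<Rightarrow> ereal) \<Rightarrow> 'a \<Rightarrow> 'a set" where
  "eps_subdiff e h x = {u. \<forall>y. h x + ereal (inner u (y - x)) - ereal e \<le> h y}"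

abbreviation subdiff :: "('a::real_inner \<Rightarrow> ereal) \<Rightarrow> 'a \<Rightarrow> 'a set" where
  "subdiff \<equiv> eps_subdiff 0"

text \<open>
  For proper, lower semicontinuous, convex \<open>h\<close> on a Hilbert space the minimizer exists and
  is unique, so the choice made by \<^const>\<open>arg_min\<close> is no choice.
\<close>

definition prox :: "('a::real_inner \<Rightarrow> ereal) \<Rightarrow> 'a \<Rightarrow> 'a" where
  "prox h x = (ARG_MIN (\<lambda>y. h y + ereal (1/2 * (norm (y - x))\<^sup>2)) y. True)"

text \<open>If this set is nonempty, then the infimum \<open>INF x. h x\<close> is a minimum.\<close>

definition minimizers :: "('a \<Rightarrow> ereal) \<Rightarrow> 'a set" where
  "minimizers h = {z. h z = (INF x. h x)}"

definition c_const :: "real \<Rightarrow> real" where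
  "c_const q =
     (if q < 1 then 5 + 2 / (1 - q)
      else if q = 1 then 9
      else (2 powr q + 3 * q - 1) / (q - 1))"

end

theory Submission
  imports Defs
begin

text \<open>
  The optimality condition of the proximity operator (\<open>prox_scale_subgradient\<close>) turns each iteration into
  \<open>x (Suc t) = x t - a t *\<^sub>R (g t + u t)\<close> with \<open>u t\<close> a subgradient of \<open>r\<close> at \<open>x (Suc t)\<close>, so all
  directions have norm at most \<open>B\<close>. Expanding \<open>norm (x (Suc t) - y)\<close> squared
  (\<open>forward_backward_step\<close>) shows that, for \<open>t \<ge> 2\<close> and every \<open>y\<close> in the domain of \<open>r\<close>, the weighted gap
  \<open>a t * (f (x t) - f y)\<close> is at most half the decrease of the squared distance to \<open>y\<close> plus
  \<open>(5 * B\<^sup>2 + \<epsilon>) * (a t)\<^sup>2\<close>.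

  Summed with \<open>y\<close> a minimizer, this bounds the average gap. To pass to the last iterate, sum the same
  inequality from \<open>j\<close> to \<open>T\<close> with \<open>y = x j\<close>: the initial distance vanishes, so the later values do not
  exceed the value at \<open>x j\<close> by much on average. Taking this into account for all \<open>j\<close>
  (\<open>last_iterate_bound\<close>) yields, with \<open>b t = (5 * B\<^sup>2 + \<epsilon>) * (a t)\<^sup>2\<close>,
  \<open>a T * (f (x T) - f\<^sub>*) \<le> A / T + b T + (\<Sum>t=1..<T. b t / (T - t))\<close>, where \<open>f\<^sub>*\<close> is the
  minimum and \<open>A\<close> is half the squared distance of \<open>x 1\<close> to a minimizer plus \<open>b 1\<close>.
  For \<open>a t = \<alpha> * t powr (-\<theta>)\<close> the right-hand side is estimated by harmonic sums and \<open>p\<close>-series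
  (\<open>last_iterate_rate\<close>).

  The initial point needs care, since \<open>f (x 1)\<close> can be infinite. Dropping the first iteration would
  replace \<open>T\<close> by \<open>T - 1\<close> in the leading term, which the stated constant does not permit. Instead the
  first iteration is kept with the value \<open>f (x 2)\<close>, so that there are \<open>T\<close> terms and the
  distance is still that of \<open>x 1\<close>; the slightly larger error of this one term is divided by \<open>T\<close>.
\<close>

section \<open>Proximity operator\<close>

lemma lsc_fun_iff:
  "lsc_fun h \<longleftrightarrow> (\<forall>x c. c < h x \<longrightarrow> (\<forall>\<^sub>F y in nhds x. c < h y))"
  unfolding lsc_fun_def le_Liminf_iff by auto

lemma proper_fun_scale:
  assumes "proper_fun h" "0 < c"
  shows "proper_fun (\<lambda>z. ereal c * h z)"
  using assms unfolding proper_fun_def by (auto simp: ereal_mult_eq_PInfty ereal_mult_eq_MInfty)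

lemma lsc_fun_scale:
  assumes "lsc_fun h" "0 < c"
  shows "lsc_fun (\<lambda>z. ereal c * h z)"
  unfolding lsc_fun_iff
proof (intro allI impI)
  have *: "d < ereal c * h z \<longleftrightarrow> d / ereal c < h z" for d z
    using assms(2) by (simp add: ereal_divide_less_iff mult.commute)
  fix x d assume "d < ereal c * h x"
  then show "\<forall>\<^sub>F y in nhds x. d < ereal c * h y"
    using assms(1) unfolding lsc_fun_iff * by blast
qed

lemma convex_fun_scale:
  assumes "convex_fun h" "0 < c"
  shows "convex_fun (\<lambda>z. ereal c * h z)"
  unfolding convex_fun_def
proof (intro allI impI)
  fix x y and u v :: real assume uv: "0 \<le> u" "0 \<le> v" "u + v = 1"
  have "ereal c * h (u *\<^sub>R x + v *\<^sub>R y) \<le> ereal c * (ereal u * h x + ereal v * h y)"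
    using assms uv by (intro ereal_mult_left_mono) (auto simp: convex_fun_def)
  also have "\<dots> = ereal u * (ereal c * h x) + ereal v * (ereal c * h y)"
    by (subst ereal_pos_distrib) (use assms(2) in \<open>auto simp: ac_simps\<close>)
  finally show "ereal c * h (u *\<^sub>R x + v *\<^sub>R y) \<le> ereal u * (ereal c * h x) + ereal v * (ereal c * h y)" .
qed

text \<open>
  Lower semicontinuity keeps \<open>h\<close> above \<open>H - 1\<close> on a ball around \<open>x0\<close>. A point further
  away is compared, along the segment to \<open>x0\<close>, with a point of that ball: by convexity \<open>h\<close> cannot
  fall along the segment faster than linearly. This elementary bound, in place of a continuous affine
  minorant, is enough to make the objective of the proximity operator bounded below.
\<close>

lemma convex_fun_linear_minorant:
  fixes h :: "'a::real_normed_vector \<Rightarrow> ereal"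
  assumes h: "proper_fun h" "lsc_fun h" "convex_fun h" and fin: "h x0 = ereal H"
  shows "\<exists>L. \<forall>y. ereal (H - 1 - L * norm (y - x0)) \<le> h y"
proof -
  have "\<forall>\<^sub>F y in nhds x0. ereal (H - 1) < h y"
    using h(2) fin unfolding lsc_fun_iff by simp
  then obtain d where d: "0 < d" "\<And>y. dist y x0 < d \<Longrightarrow> ereal (H - 1) < h y"
    unfolding eventually_nhds_metric by auto
  have "ereal (H - 1 - 2 / d * norm (y - x0)) \<le> h y" for y
  proof (cases "dist y x0 < d")
    case True
    have "ereal (H - 1 - 2 / d * norm (y - x0)) \<le> ereal (H - 1)"
      using d(1) by simp
    also have "\<dots> \<le> h y" using d(2)[OF True] by simp
    finally show ?thesis .
  next
    case far: False
    show ?thesis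
    proof (cases "h y")
      case (real Hy)
      define n where "n = norm (y - x0)"
      have n: "0 < n" "d \<le> n" using far d(1) by (auto simp: n_def dist_norm)
      \<comment> \<open>This parameter puts \<open>z\<close> at distance \<open>d / 2\<close> from \<open>x0\<close>, inside the ball.\<close>
      define s where "s = d / (2 * n)"
      have s: "0 < s" "s \<le> 1" using n d(1) by (auto simp: s_def field_simps)
      define z where "z = (1 - s) *\<^sub>R x0 + s *\<^sub>R y"
      have "z - x0 = s *\<^sub>R (y - x0)" by (simp add: z_def algebra_simps)
      then have "dist z x0 = s * n" using s by (simp add: dist_norm n_def)
      also have "\<dots> < d" using n d(1) by (simp add: s_def)
      finally have "ereal (H - 1) < h z" by (rule d(2))
      also have "h z \<le> ereal (1 - s) * h x0 + ereal s * h y"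
        using h(3) s unfolding z_def convex_fun_def by (metis add.commute diff_add_cancel diff_ge_0_iff_ge less_imp_le)
      also have "\<dots> = ereal ((1 - s) * H + s * Hy)" by (simp add: fin real)
      finally have "s * (H - Hy) \<le> 1" by (simp add: algebra_simps)
      then have "H - Hy \<le> 1 / s" using s by (simp add: field_simps)
      also have "1 / s = 2 / d * n" using d(1) n by (simp add: s_def)
      finally show ?thesis by (simp add: real n_def)
    next
      case MInf
      then show ?thesis using h(1) by (simp add: proper_fun_def)
    qed simp
  qed
  then show ?thesis by blast
qed

text \<open>
  The objective is bounded below, since the square dominates the linear minorant of \<open>h\<close>. It is
  strongly convex, so the midpoint of two nearly optimal points would be too good unless the points are
  close: minimizing sequences are Cauchy. Lower semicontinuity makes their limit a minimizer.
\<close>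

lemma prox_objective_has_minimizer:
  fixes h :: "'a::{real_inner, complete_space} \<Rightarrow> ereal"
  assumes h: "proper_fun h" "lsc_fun h" "convex_fun h"
  shows "\<exists>p. \<forall>y. h p + ereal (1/2 * (norm (p - x))\<^sup>2) \<le> h y + ereal (1/2 * (norm (y - x))\<^sup>2)"
proof -
  define \<phi> where "\<phi> y = h y + ereal (1/2 * (norm (y - x))\<^sup>2)" for y
  have ninf: "h y \<noteq> -\<infinity>" for y using h(1) by (simp add: proper_fun_def)
  obtain x0 where "h x0 \<noteq> \<infinity>" using h(1) by (auto simp: proper_fun_def)
  then obtain H where H: "h x0 = ereal H" using ninf[of x0] by (cases "h x0") auto
  obtain L where L: "\<And>y. ereal (H - 1 - L * norm (y - x0)) \<le> h y"
    using convex_fun_linear_minorant[OF h H] by blast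
  \<comment> \<open>From \<open>\<bar>L\<bar> * n \<le> n\<^sup>2 / 2 + L\<^sup>2 / 2\<close> with \<open>n = norm (y - x)\<close>.\<close>
  define C where "C = H - 1 - \<bar>L\<bar> * norm (x - x0) - L\<^sup>2 / 2"
  have "ereal C \<le> \<phi> y" for y
  proof -
    have "L * norm (y - x0) \<le> \<bar>L\<bar> * (norm (y - x) + norm (x - x0))"
      using norm_triangle_ineq[of "y - x" "x - x0"] by (intro mult_mono) auto
    moreover have "0 \<le> (norm (y - x) - \<bar>L\<bar>)\<^sup>2" by simp
    ultimately have "C \<le> H - 1 - L * norm (y - x0) + 1/2 * (norm (y - x))\<^sup>2"
      by (simp add: C_def power2_diff algebra_simps)
    then have "ereal C \<le> ereal (H - 1 - L * norm (y - x0)) + ereal (1/2 * (norm (y - x))\<^sup>2)"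
      by simp
    also have "\<dots> \<le> \<phi> y"
      unfolding \<phi>_def by (intro add_right_mono L)
    finally show ?thesis .
  qed
  then have "ereal C \<le> (INF y. \<phi> y)" by (intro INF_greatest)
  moreover have "(INF y. \<phi> y) \<le> \<phi> x0" by (rule INF_lower) simp
  ultimately obtain M where M: "(INF y. \<phi> y) = ereal M"
    by (cases "INF y. \<phi> y") (auto simp: \<phi>_def H)
  have low: "ereal M \<le> \<phi> y" for y
    unfolding M[symmetric] by (rule INF_lower) simp
  have "\<exists>y. \<phi> y < ereal (M + 1 / real (Suc n))" for n
    using INF_less_iff[of \<phi> UNIV "ereal (M + 1 / real (Suc n))"] M by auto
  then obtain Y where Y: "\<And>n. \<phi> (Y n) < ereal (M + 1 / real (Suc n))" by metis
  define F where "F n = real_of_ereal (h (Y n))" for n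
  have F: "h (Y n) = ereal (F n)" for n
    using Y[of n] ninf[of "Y n"] unfolding F_def \<phi>_def by (cases "h (Y n)") auto
  have up: "F n + 1/2 * (norm (Y n - x))\<^sup>2 \<le> M + 1 / real (Suc n)" for n
    using Y[of n] by (simp add: \<phi>_def F)
  have gap: "(norm (Y i - Y j))\<^sup>2 \<le> 4 * (1 / real (Suc i) + 1 / real (Suc j))" for i j
  proof -
    define \<beta> where "\<beta> n = 1 / real (Suc n)" for n
    define m where "m = (1/2) *\<^sub>R Y i + (1/2) *\<^sub>R Y j"
    have "ereal M \<le> h m + ereal (1/2 * (norm (m - x))\<^sup>2)"
      using low[of m] by (simp add: \<phi>_def)
    also have "h m \<le> ereal (1/2) * h (Y i) + ereal (1/2) * h (Y j)"
      using h(3) unfolding m_def convex_fun_def by (metis field_sum_of_halves half_gt_zero_iff less_imp_le zero_less_one)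
    finally have "M \<le> (F i + F j) / 2 + 1/2 * (norm (m - x))\<^sup>2"
      by (simp add: F add_right_mono add_divide_distrib)
    moreover have "(norm (m - x))\<^sup>2 = ((norm (Y i - x))\<^sup>2 + (norm (Y j - x))\<^sup>2) / 2 - (norm (Y i - Y j))\<^sup>2 / 4"
      unfolding m_def power2_norm_eq_inner by (simp add: inner_simps inner_commute field_simps)
    ultimately show ?thesis using up[of i] up[of j]
      unfolding \<beta>_def[symmetric] by (simp add: field_simps)
  qed
  have "Cauchy Y"
  proof (rule metric_CauchyI)
    fix \<delta> :: real assume \<delta>: "0 < \<delta>"
    obtain N where N: "8 / \<delta>\<^sup>2 < real N" using reals_Archimedean2 by blast
    have "dist (Y i) (Y j) < \<delta>" if ij: "N \<le> i" "N \<le> j" for i j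
    proof -
      have "1 / real (Suc i) \<le> 1 / real (Suc N)" "1 / real (Suc j) \<le> 1 / real (Suc N)"
        using ij by (auto intro!: divide_left_mono)
      then have "(norm (Y i - Y j))\<^sup>2 \<le> 8 / real (Suc N)" using gap[of i j] by simp
      also have "\<dots> < \<delta>\<^sup>2" using N \<delta> by (simp add: field_simps) (smt (verit) zero_less_power)
      finally show ?thesis using \<delta> by (simp add: dist_norm power2_less_imp_less)
    qed
    then show "\<exists>N. \<forall>i\<ge>N. \<forall>j\<ge>N. dist (Y i) (Y j) < \<delta>" by blast
  qed
  then obtain p where p: "Y \<longlonglongrightarrow> p"
    using Cauchy_convergent convergent_def by blast
  have "\<phi> p \<le> ereal M"
  proof (rule ccontr)
    assume "\<not> \<phi> p \<le> ereal M"
    then have "ereal (M - 1/2 * (norm (p - x))\<^sup>2) < h p"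
      unfolding \<phi>_def by (cases "h p") auto
    then obtain c where c: "ereal (M - 1/2 * (norm (p - x))\<^sup>2) < ereal c" "ereal c < h p"
      using ereal_dense2 by blast
    have "\<forall>\<^sub>F y in nhds p. ereal c < h y"
      using h(2) c(2) unfolding lsc_fun_iff by blast
    then have "\<forall>\<^sub>F n in sequentially. c < F n"
      using p F by (auto simp: filterlim_iff)
    then have "\<forall>\<^sub>F n in sequentially. c + 1/2 * (norm (Y n - x))\<^sup>2 \<le> M + 1 / real (Suc n)"
      by eventually_elim (use up in \<open>smt (verit)\<close>)
    moreover have "(\<lambda>n. c + 1/2 * (norm (Y n - x))\<^sup>2) \<longlonglongrightarrow> c + 1/2 * (norm (p - x))\<^sup>2"
      by (intro tendsto_intros p)
    moreover have "(\<lambda>n. M + 1 / real (Suc n)) \<longlonglongrightarrow> M + 0"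
      by (intro tendsto_add tendsto_const LIMSEQ_Suc[OF lim_1_over_n])
    ultimately have "c + 1/2 * (norm (p - x))\<^sup>2 \<le> M + 0"
      using tendsto_le[OF sequentially_bot] by blast
    then show False using c(1) by simp
  qed
  then have "\<forall>y. \<phi> p \<le> \<phi> y" using low order_trans by blast
  then show ?thesis unfolding \<phi>_def by blast
qed

text \<open>
  Compare the minimizer \<open>p\<close> with the point at parameter \<open>s\<close> of the segment from \<open>p\<close> to \<open>y\<close>: after
  division by \<open>s\<close>, the subgradient inequality holds up to an error of order \<open>s\<close>, and \<open>s\<close>
  tends to zero.
\<close>

lemma prox_subgradient:
  fixes h :: "'a::{real_inner, complete_space} \<Rightarrow> ereal"
  assumes h: "proper_fun h" "lsc_fun h" "convex_fun h"
  shows "h (prox h x) \<noteq> \<infinity>" and "x - prox h x \<in> subdiff h (prox h x)"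
proof -
  define p where "p = prox h x"
  have ninf: "h y \<noteq> -\<infinity>" for y using h(1) by (simp add: proper_fun_def)
  have "\<exists>p. is_arg_min (\<lambda>y. h y + ereal (1/2 * (norm (y - x))\<^sup>2)) (\<lambda>_. True) p"
    using prox_objective_has_minimizer[OF h, of x] by (simp add: is_arg_min_linorder)
  then have "is_arg_min (\<lambda>y. h y + ereal (1/2 * (norm (y - x))\<^sup>2)) (\<lambda>_. True) p"
    unfolding p_def prox_def arg_min_def by (rule someI_ex)
  then have min: "h p + ereal (1/2 * (norm (p - x))\<^sup>2) \<le> h y + ereal (1/2 * (norm (y - x))\<^sup>2)" for y
    by (simp add: is_arg_min_linorder)
  obtain x0 where "h x0 \<noteq> \<infinity>" using h(1) by (auto simp: proper_fun_def)
  then have pinf: "h p \<noteq> \<infinity>" using min[of x0] by auto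
  then show "h (prox h x) \<noteq> \<infinity>" by (simp add: p_def)
  obtain P where P: "h p = ereal P" using pinf ninf[of p] by (cases "h p") auto
  have "h p + ereal (inner (x - p) (y - p)) - ereal 0 \<le> h y" for y
  proof (cases "h y")
    case (real R)
    have "P + inner (x - p) (y - p) - R \<le> s * ((norm (y - p))\<^sup>2 / 2)" if s: "0 < s" "s \<le> 1" for s
    proof -
      define z where "z = (1 - s) *\<^sub>R p + s *\<^sub>R y"
      have z: "z - x = (p - x) + s *\<^sub>R (y - p)" by (simp add: z_def algebra_simps)
      have "h p + ereal (1/2 * (norm (p - x))\<^sup>2) \<le> h z + ereal (1/2 * (norm (z - x))\<^sup>2)" by (rule min)
      also have "h z \<le> ereal (1 - s) * h p + ereal s * h y"
        using h(3) s unfolding z_def convex_fun_def by (metis add.commute diff_add_cancel diff_ge_0_iff_ge less_imp_le)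
      finally have "P + 1/2 * (norm (p - x))\<^sup>2 \<le> (1 - s) * P + s * R + 1/2 * (norm (z - x))\<^sup>2"
        by (simp add: P real add_right_mono)
      moreover have "(norm (z - x))\<^sup>2 = (norm (p - x))\<^sup>2 - 2 * s * inner (x - p) (y - p) + s\<^sup>2 * (norm (y - p))\<^sup>2"
        unfolding z power2_norm_eq_inner
        by (simp add: inner_simps inner_commute algebra_simps power2_eq_square)
      ultimately have "s * (P + inner (x - p) (y - p) - R) \<le> s * (s * ((norm (y - p))\<^sup>2 / 2))"
        by (simp add: algebra_simps power2_eq_square)
      then show ?thesis using s by simp
    qed
    then have "\<forall>\<^sub>F s in at_right (0::real). P + inner (x - p) (y - p) - R \<le> s * ((norm (y - p))\<^sup>2 / 2)"
      unfolding eventually_at_right_field by (intro exI[of _ 1]) auto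
    moreover have "((\<lambda>s. s * ((norm (y - p))\<^sup>2 / 2)) \<longlongrightarrow> 0 * ((norm (y - p))\<^sup>2 / 2)) (at_right (0::real))"
      by (intro tendsto_intros)
    ultimately have "P + inner (x - p) (y - p) - R \<le> 0"
      using tendsto_lowerbound[of _ _ "at_right (0::real)"] by fastforce
    then show ?thesis by (simp add: P real)
  qed (use ninf[of y] in auto)
  then show "x - prox h x \<in> subdiff h (prox h x)"
    by (simp add: eps_subdiff_def p_def)
qed

text \<open>
  Hence a proximal step of length \<open>c\<close> is an implicit subgradient step: \<open>p = x - c *\<^sub>R u\<close> with
  \<open>u\<close> a subgradient of \<open>h\<close> at the new point \<open>p\<close>.
\<close>

lemma prox_scale_subgradient:
  fixes h :: "'a::{real_inner, complete_space} \<Rightarrow> ereal"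
  assumes h: "proper_fun h" "lsc_fun h" "convex_fun h" and c: "0 < c"
    and p: "p = prox (\<lambda>z. ereal c * h z) x"
  shows "h p \<noteq> \<infinity>" and "(1 / c) *\<^sub>R (x - p) \<in> subdiff h p"
proof -
  note ch = proper_fun_scale[OF h(1) c] lsc_fun_scale[OF h(2) c] convex_fun_scale[OF h(3) c]
  show fin: "h p \<noteq> \<infinity>"
    using prox_subgradient(1)[OF ch, of x] c by (auto simp: p[symmetric])
  then obtain P where P: "h p = ereal P"
    using h(1) by (cases "h p") (auto simp: proper_fun_def)
  have sub: "ereal c * h p + ereal (inner (x - p) (y - p)) \<le> ereal c * h y" for y
    using prox_subgradient(2)[OF ch, of x] by (simp add: p[symmetric] eps_subdiff_def)
  have "h p + ereal (inner ((1 / c) *\<^sub>R (x - p)) (y - p)) \<le> h y" for y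
    unfolding inner_scaleR_left using sub[of y] c h(1) by (cases "h y") (auto simp: P proper_fun_def field_simps)
  then show "(1 / c) *\<^sub>R (x - p) \<in> subdiff h p"
    by (simp add: eps_subdiff_def)
qed

section \<open>From averages to the last iterate\<close>

lemma sum_le_telescope:
  fixes P :: "nat \<Rightarrow> real"
  assumes "j \<le> Suc T" "0 \<le> P (Suc T)" "\<And>t. j \<le> t \<Longrightarrow> t \<le> T \<Longrightarrow> v t \<le> P t - P (Suc t)"
  shows "(\<Sum>t=j..T. v t) \<le> P j"
proof -
  have "(\<Sum>t=j..T. v t) \<le> (\<Sum>t=j..T. - (P (Suc t) - P t))"
    using assms(3) by (intro sum_mono) auto
  also have "\<dots> = P j - P (Suc T)"
    unfolding sum_negf sum_Suc_diff[OF assms(1)] by simp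
  finally show ?thesis using assms(2) by simp
qed

text \<open>
  Let \<open>V j\<close> be the sum of \<open>a t * u t - b t\<close> over the tail \<open>j..T\<close>. Restarting the comparison at \<open>j\<close>
  bounds \<open>V j\<close> by the sum of \<open>a t * u j\<close>, hence by \<open>(T + 1 - j) * (a j * u j)\<close> because the weights
  decrease. So the entry \<open>j\<close> carries at least the average share of its tail, up to \<open>b j\<close>, and
  removing it changes the tail average from \<open>V j / (T + 1 - j)\<close> to at most that value plus
  \<open>b j / (T - j)\<close>. Iterating from the full average (\<open>j = 1\<close>) down to the single entry \<open>T\<close> turns a bound
  on the average into one on the last value. Since \<open>b t\<close> is subtracted inside \<open>V\<close>, each \<open>b t\<close>
  appears only once in the result, with weight \<open>1 / (T - t)\<close>.
\<close>

lemma last_iterate_bound: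
  fixes a u b :: "nat \<Rightarrow> real"
  assumes T: "1 \<le> T"
    and u: "\<And>t. 1 \<le> t \<Longrightarrow> 0 \<le> u t"
    and a: "\<And>s t. 1 \<le> s \<Longrightarrow> s \<le> t \<Longrightarrow> a t \<le> a s"
    and start: "(\<Sum>t=1..T. a t * u t - b t) \<le> A"
    and restart: "\<And>j. 1 \<le> j \<Longrightarrow> j < T \<Longrightarrow> (\<Sum>t=j..T. a t * (u t - u j) - b t) \<le> 0"
  shows "a T * u T \<le> A / T + b T + (\<Sum>t=1..<T. b t / real (T - t))"
proof -
  define V where "V j = (\<Sum>t=j..T. a t * u t - b t)" for j
  have "a T * u T \<le> V j / real (Suc T - j) + b T + (\<Sum>t=j..<T. b t / real (T - t))"
    if "j \<le> T" "1 \<le> j" for j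
    using that
  proof (induction j rule: inc_induct)
    case base
    then show ?case by (simp add: V_def)
  next
    case (step j)
    define k where "k = real (T - j)"
    have k: "0 < k" "real (Suc T - j) = k + 1" "real (Suc T - Suc j) = k"
      using step.hyps by (auto simp: k_def of_nat_diff)
    have split: "V j = (a j * u j - b j) + V (Suc j)"
      using step.hyps unfolding V_def by (simp add: sum.atLeast_Suc_atMost)
    have "V j \<le> (\<Sum>t=j..T. a t * u j)"
      using restart[of j] step
      by (simp add: V_def sum_subtractf sum.distrib algebra_simps)
    also have "\<dots> \<le> (\<Sum>t=j..T. a j * u j)"
      using a u step by (intro sum_mono mult_right_mono) auto
    also have "\<dots> = (k + 1) * (a j * u j)"
      using k by simp
    finally have "V j / (k + 1) \<le> a j * u j"
      using k by (simp add: field_simps)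
    then have "V (Suc j) / k \<le> (V j - V j / (k + 1) + b j) / k"
      using k split by (intro divide_right_mono) auto
    also have "\<dots> = V j / (k + 1) + b j / k"
      using k by (simp add: field_simps)
    finally have "V (Suc j) / k \<le> V j / (k + 1) + b j / k" .
    moreover have "(\<Sum>t=j..<T. b t / real (T - t)) = b j / k + (\<Sum>t=Suc j..<T. b t / real (T - t))"
      using step.hyps by (simp add: sum.atLeast_Suc_lessThan k_def)
    ultimately show ?case
      using step.IH unfolding k by linarith
  qed
  from this[of 1] have "a T * u T \<le> V 1 / T + b T + (\<Sum>t=1..<T. b t / real (T - t))"
    using T by simp
  moreover have "V 1 / T \<le> A / T"
    using start by (intro divide_right_mono) (auto simp: V_def)
  ultimately show ?thesis by simp
qed

section \<open>Decay rates for polynomial step sizes\<close>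

lemma sum_inverse_le:
  assumes "1 \<le> (T::nat)"
  shows "(\<Sum>t=1..<T. 1 / real t) \<le> 1 + ln T"
proof -
  have "(\<Sum>t=1..<T. 1 / real t) \<le> (\<Sum>t=1..T. 1 / real t)"
    by (intro sum_mono2) auto
  also have "\<dots> = harm T" by (simp add: harm_def inverse_eq_divide)
  also have "\<dots> \<le> 1 + ln T"
    using euler_mascheroni_sequence_decreasing[of 1 T] assms by (simp add: harm_def)
  finally show ?thesis .
qed

text \<open>
  Since \<open>1 - p \<ge> 0\<close>, one has \<open>t powr (-p) \<le> T powr (-p) * (T / t)\<close>, and
  \<open>T / (t * (T - t)) = 1 / t + 1 / (T - t)\<close> reduces the sum to two harmonic sums.
\<close>

lemma sum_powr_div_diff_le:
  fixes p :: real and T :: nat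
  assumes p: "p \<le> 1" and T: "1 \<le> T"
  shows "(\<Sum>t=1..<T. real t powr (-p) / real (T - t)) \<le> 2 * real T powr (-p) * (1 + ln T)"
proof -
  have "(\<Sum>t=1..<T. real t powr (-p) / real (T - t))
      \<le> (\<Sum>t=1..<T. real T powr (-p) * (1 / real t + 1 / real (T - t)))"
  proof (intro sum_mono)
    fix t assume t: "t \<in> {1..<T}"
    have "real t powr (-p) = real t powr (1 - p) / real t"
      using t by (simp add: powr_diff powr_minus field_simps)
    also have "\<dots> \<le> real T powr (1 - p) / real t"
      using t p by (intro divide_right_mono powr_mono2) auto
    also have "\<dots> = real T powr (-p) * (T / t)"
      using T by (simp add: powr_diff powr_minus field_simps)
    finally have "real t powr (-p) / real (T - t) \<le> real T powr (-p) * (T / t) / real (T - t)"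
      using t by (intro divide_right_mono) auto
    also have "\<dots> = real T powr (-p) * (1 / real t + 1 / real (T - t))"
      using t by (simp add: field_simps of_nat_diff)
    finally show "real t powr (-p) / real (T - t)
      \<le> real T powr (-p) * (1 / real t + 1 / real (T - t))" .
  qed
  also have "\<dots> = real T powr (-p) * ((\<Sum>t=1..<T. 1 / real t) + (\<Sum>t=1..<T. 1 / real (T - t)))"
    by (simp only: sum_distrib_left[symmetric] sum.distrib)
  also have "(\<Sum>t=1..<T. 1 / real (T - t)) = (\<Sum>t=1..<T. 1 / real t)"
    by (rule sum.reindex_bij_witness[where i="\<lambda>t. T - t" and j="\<lambda>t. T - t"]) auto
  finally show ?thesis
    using sum_inverse_le[OF T] mult_left_mono[OF sum_inverse_le[OF T], of "2 * real T powr (-p)"]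
    by (simp add: algebra_simps)
qed

text \<open>
  The right-hand side is one plus the integral of \<open>s powr (-q)\<close> over \<open>1..T\<close>. The induction step
  compares one term with the integral over a unit interval; divided by \<open>N powr (1 - q)\<close>, it says
  \<open>1 + (q - 1) / N \<le> (1 - 1/N) powr (1 - q)\<close>, which follows from \<open>ln (1 - 1/N) \<le> - 1/N\<close> and
  \<open>1 + s \<le> exp s\<close>.
\<close>

lemma sum_powr_le:
  fixes q :: real and T :: nat
  assumes q: "1 < q" and T: "1 \<le> T"
  shows "(\<Sum>t=1..<Suc T. real t powr (-q)) \<le> (q - real T powr (1 - q)) / (q - 1)"
  using T
proof (induction T rule: nat_induct_at_least)
  case base
  then show ?case using q by simp
next
  case (Suc n)
  define N where "N = real (Suc n)"
  have N: "1 < N" "real n = N * (1 - 1/N)" using Suc.hyps by (auto simp: N_def field_simps)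
  have "1 / N \<le> - ln (1 - 1/N)"
    using ln_add_one_self_le_self2[of "- (1/N)"] N by simp
  then have "(q - 1) * (1 / N) \<le> (1 - q) * ln (1 - 1/N)"
    using mult_left_mono[of "1/N" "- ln (1 - 1/N)" "q - 1"] q by (simp add: algebra_simps)
  then have "1 + (q - 1) / N \<le> exp ((1 - q) * ln (1 - 1/N))"
    using exp_ge_add_one_self[of "(1 - q) * ln (1 - 1/N)"] by (simp add: field_simps)
  also have "\<dots> = (1 - 1/N) powr (1 - q)"
    using N by (simp add: powr_def)
  finally have "N powr (1 - q) * (1 + (q - 1) / N) \<le> N powr (1 - q) * (1 - 1/N) powr (1 - q)"
    by (intro mult_left_mono) auto
  also have "\<dots> = real n powr (1 - q)"
    unfolding N(2) using N by (subst powr_mult) auto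
  finally have "N powr (1 - q) + (q - 1) * (N powr (1 - q) / N) \<le> real n powr (1 - q)"
    by (simp add: algebra_simps)
  moreover have "N powr (1 - q) / N = N powr (- q)"
    using N by (simp add: powr_diff powr_minus field_simps)
  ultimately have "N powr (-q) \<le> (real n powr (1 - q) - N powr (1 - q)) / (q - 1)"
    using q by (simp add: field_simps)
  moreover have "(\<Sum>t=1..<Suc (Suc n). real t powr (-q)) = (\<Sum>t=1..<Suc n. real t powr (-q)) + N powr (-q)"
    by (simp add: N_def)
  moreover have "(q - real n powr (1 - q)) / (q - 1) + (real n powr (1 - q) - N powr (1 - q)) / (q - 1)
     = (q - N powr (1 - q)) / (q - 1)"
    by (simp add: diff_divide_distrib)
  ultimately show ?case
    using Suc.IH by (simp add: N_def)
qed

text \<open>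
  Relative to \<open>T powr (-q)\<close>, the left-hand side is at most \<open>4 + 2 * ln T\<close>: the first two
  terms contribute at most one each and the sum at most \<open>2 + 2 * ln T\<close>. Both definitions of the constant for
  \<open>q \<le> 1\<close> give at least \<open>7\<close>, and \<open>4 + 2 * ln T \<le> 7 * ln T\<close> holds from \<open>T = 4\<close> on.
\<close>

lemma weighted_sum_le_log:
  fixes q :: real and T :: nat
  assumes q: "0 \<le> q" "q \<le> 1" and T: "3 < T"
  shows "1 / T + real T powr (-q) + (\<Sum>t=1..<T. real t powr (-q) / real (T - t))
       \<le> c_const q * ln T * real T powr (-q)"
proof -
  \<comment> \<open>\<open>ln T \<ge> ln 4 = 2 * ln 2\<close>, and \<open>4/3\<close> exceeds \<open>4/5\<close>, the value that the constant \<open>7\<close> requires.\<close>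
  have "2 * (2/3) \<le> 2 * ln (2::real)"
    using ln2_ge_two_thirds by simp
  also have "\<dots> = ln (2 ^ 2)"
    by (subst ln_realpow) auto
  also have "\<dots> \<le> ln T"
    using T by (subst ln_le_cancel_iff) auto
  finally have ln: "4/3 \<le> ln T" by simp
  have "7 * ln T \<le> c_const q * ln T"
    using q ln by (intro mult_right_mono) (auto simp: c_const_def field_simps)
  then have c: "4 + 2 * ln T \<le> c_const q * ln T"
    using ln by linarith
  have "real T powr (-1) \<le> real T powr (-q)"
    using q T by (intro powr_mono) auto
  then have "1 / T \<le> real T powr (-q)"
    using T by (simp add: powr_minus divide_inverse)
  then have "1 / T + real T powr (-q) + (\<Sum>t=1..<T. real t powr (-q) / real (T - t))
     \<le> real T powr (-q) * (4 + 2 * ln T)"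
    using sum_powr_div_diff_le[OF q(2), of T] T by (simp add: algebra_simps)
  also have "\<dots> \<le> real T powr (-q) * (c_const q * ln T)"
    using c by (intro mult_left_mono) auto
  finally show ?thesis by (simp add: algebra_simps)
qed

text \<open>
  For \<open>q > 1\<close> the factor \<open>T / (T - t) = 1 + t / (T - t)\<close> splits \<open>T\<close> times the sum into a convergent
  \<open>p\<close>-series, at most \<open>q / (q - 1)\<close>, and a sum with exponent \<open>q - 1 \<le> 1\<close>, at most
  \<open>2 * y * (1 + ln T)\<close> with \<open>y = T powr (1 - q)\<close>. The logarithm is absorbed by the power:
  \<open>1 + s \<le> exp s\<close> gives \<open>y * ln T \<le> (1 - y) / (q - 1)\<close>. What remains is affine in \<open>y\<close>, with
  \<open>0 \<le> y \<le> 1\<close>, and is below the constant because \<open>2 \<le> 2 powr q\<close> and \<open>q < 2\<close>.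
\<close>

lemma weighted_sum_le_const:
  fixes q :: real and T :: nat
  assumes q: "1 < q" "q < 2" and T: "3 < T"
  shows "1 / T + real T powr (-q) + (\<Sum>t=1..<T. real t powr (-q) / real (T - t)) \<le> c_const q / T"
proof -
  define y where "y = real T powr (1 - q)"
  have y: "0 < y" "y \<le> 1"
    using T q powr_mono[of "1 - q" 0 "real T"] by (auto simp: y_def)
  have Tq: "T * real T powr (-q) = y"
    using T by (simp add: y_def powr_diff powr_minus field_simps)
  have "y * (1 + (q - 1) * ln T) \<le> y * exp ((q - 1) * ln T)"
    using y by (intro mult_left_mono exp_ge_add_one_self) auto
  also have "\<dots> = 1"
    using T by (simp add: y_def powr_def exp_add[symmetric] algebra_simps)
  finally have log: "y * ln T \<le> (1 - y) / (q - 1)"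
    using q by (simp add: field_simps)
  have "T * (\<Sum>t=1..<T. real t powr (-q) / real (T - t))
     = (\<Sum>t=1..<T. real t powr (-q) + real t powr (-(q - 1)) / real (T - t))"
    unfolding sum_distrib_left
  proof (intro sum.cong refl)
    fix t assume t: "t \<in> {1..<T}"
    have "real t powr (-(q - 1)) = t * real t powr (-q)"
      using t by (simp add: powr_diff powr_minus field_simps)
    then show "T * (real t powr (-q) / real (T - t))
       = real t powr (-q) + real t powr (-(q - 1)) / real (T - t)"
      using t by (simp add: field_simps of_nat_diff)
  qed
  also have "\<dots> = (\<Sum>t=1..<T. real t powr (-q)) + (\<Sum>t=1..<T. real t powr (-(q - 1)) / real (T - t))"
    by (rule sum.distrib)
  also have "\<dots> \<le> q / (q - 1) + 2 * y * (1 + ln T)"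
  proof (intro add_mono)
    have "(\<Sum>t=1..<T. real t powr (-q)) \<le> (\<Sum>t=1..<Suc T. real t powr (-q))"
      by (intro sum_mono2) auto
    also have "\<dots> \<le> q / (q - 1)"
      using sum_powr_le[of q T] q T y by (auto simp: y_def[symmetric] diff_divide_distrib elim: order_trans)
    finally show "(\<Sum>t=1..<T. real t powr (-q)) \<le> q / (q - 1)" .
    show "(\<Sum>t=1..<T. real t powr (-(q - 1)) / real (T - t)) \<le> 2 * y * (1 + ln T)"
      using sum_powr_div_diff_le[of "q - 1" T] q T by (simp add: y_def)
  qed
  finally have S: "T * (\<Sum>t=1..<T. real t powr (-q) / real (T - t)) \<le> q / (q - 1) + 2 * y + 2 * (y * ln T)"
    by (simp add: algebra_simps)
  have "T * (1 / T + real T powr (-q) + (\<Sum>t=1..<T. real t powr (-q) / real (T - t)))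
     = 1 + y + T * (\<Sum>t=1..<T. real t powr (-q) / real (T - t))"
    using T Tq by (simp add: distrib_left)
  also have "\<dots> \<le> 1 + 3 * y + q / (q - 1) + 2 * ((1 - y) / (q - 1))"
    using S log by linarith
  also have "\<dots> = ((q - 1) * (1 + 3 * y) + q + 2 * (1 - y)) / (q - 1)"
    using q by (simp add: add_divide_distrib)
  also have "\<dots> \<le> c_const q"
  proof -
    have "2 powr 1 \<le> 2 powr q"
      using q by (intro powr_mono) auto
    moreover have "y * (q - 1) \<le> 1 * (q - 1)" "y * q \<le> y * 2"
      using y q by (intro mult_right_mono mult_left_mono; simp)+
    moreover have "(q - 1) * (1 + 3 * y) + q + 2 * (1 - y) = 2 * q + 1 + 3 * (y * q) - 5 * y"
      by (simp add: algebra_simps)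
    ultimately have "(q - 1) * (1 + 3 * y) + q + 2 * (1 - y) \<le> 2 powr q + 3 * q - 1"
      by (simp add: right_diff_distrib)
    then show ?thesis
      using q by (simp add: c_const_def divide_right_mono)
  qed
  finally show ?thesis
    using T by (simp add: field_simps)
qed

lemma last_iterate_rate:
  fixes \<theta> :: real and T :: nat
  assumes \<theta>: "0 \<le> \<theta>" "\<theta> < 1" and T: "3 < T"
  shows "real T powr \<theta> * (1 / T + real T powr (-(2 * \<theta>))
            + (\<Sum>t=1..<T. real t powr (-(2 * \<theta>)) / real (T - t)))
       \<le> c_const (2 * \<theta>) * ln T ^ (if 2 * \<theta> \<le> 1 then 1 else 0) * real T powr (- min \<theta> (1 - \<theta>))"
    (is "_ * ?W \<le> _")
proof (cases "2 * \<theta> \<le> 1")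
  case True
  then have "real T powr \<theta> * ?W \<le> real T powr \<theta> * (c_const (2 * \<theta>) * ln T * real T powr (-(2 * \<theta>)))"
    using \<theta> T by (intro mult_left_mono weighted_sum_le_log) auto
  also have "\<dots> = c_const (2 * \<theta>) * ln T * (real T powr \<theta> * real T powr (-(2 * \<theta>)))"
    by simp
  also have "real T powr \<theta> * real T powr (-(2 * \<theta>)) = real T powr (-\<theta>)"
    using T by (simp add: powr_add[symmetric])
  finally show ?thesis
    using True by (simp add: min_def)
next
  case False
  then have "real T powr \<theta> * ?W \<le> real T powr \<theta> * (c_const (2 * \<theta>) / T)"
    using \<theta> T by (intro mult_left_mono weighted_sum_le_const) auto
  also have "\<dots> = c_const (2 * \<theta>) * real T powr (\<theta> - 1)"
    using T by (simp add: powr_diff field_simps)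
  finally show ?thesis
    using False by (simp add: min_def)
qed

section \<open>Convergence of the forward-backward iteration\<close>

text \<open>
  One step \<open>x' = x - c *\<^sub>R (g + u)\<close> naturally controls the mixed value \<open>lx + rx'\<close>, because \<open>g\<close> is an
  (approximate) subgradient at the old point and \<open>u\<close> one at the new point. Expanding the square gives the
  error \<open>c\<^sup>2 * ((norm g)\<^sup>2 - (norm u)\<^sup>2) / 2\<close>. The target value \<open>v\<close> may exceed the mixed one by a
  first-order term with some \<open>w\<close> and by \<open>d\<close>; this allows both for moving \<open>r\<close> back to the old
  point and for moving \<open>l\<close> forward to the new one. The negative square of \<open>norm u\<close> pays
  for part of this, leaving \<open>2 * B\<^sup>2\<close> in all.
\<close>

lemma forward_backward_step:
  fixes x x' z g u w :: "'a::real_inner" and c B v lx lz rx' rz e d :: real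
  assumes x': "x' = x - c *\<^sub>R (g + u)" and c: "0 \<le> c"
    and l: "lx + inner g (z - x) - e \<le> lz"
    and r: "rx' + inner u (z - x') \<le> rz"
    and v: "v \<le> lx + rx' + inner w (x - x') + d"
    and B: "norm g \<le> B" "norm u \<le> B" "norm w \<le> B"
  shows "c * (v - (lz + rz)) \<le> ((norm (x - z))\<^sup>2 - (norm (x' - z))\<^sup>2) / 2 + 2 * B\<^sup>2 * c\<^sup>2 + c * (e + d)"
proof -
  have "0 \<le> B" using B(1) norm_ge_zero order_trans by blast
  have "inner w (x - x') = c * inner w (g + u)" by (simp add: x')
  also have "\<dots> \<le> c * (B * (B + norm u))"
  proof (intro mult_left_mono c)
    have "inner w (g + u) \<le> norm w * norm (g + u)" by (rule norm_cauchy_schwarz)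
    also have "\<dots> \<le> B * (B + norm u)"
      using B \<open>0 \<le> B\<close> norm_triangle_ineq[of g u] by (intro mult_mono) auto
    finally show "inner w (g + u) \<le> B * (B + norm u)" .
  qed
  finally have w: "inner w (x - x') \<le> c * (B * (B + norm u))" .
  have eq: "c * (inner g (x - z) + inner u (x' - z))
     = ((norm (x - z))\<^sup>2 - (norm (x' - z))\<^sup>2) / 2 + c\<^sup>2 * (((norm g)\<^sup>2 - (norm u)\<^sup>2) / 2)"
    unfolding x' power2_norm_eq_inner
    by (simp add: inner_simps inner_commute field_simps power2_eq_square[of c])
  have "v - (lz + rz) \<le> inner g (x - z) + inner u (x' - z) + e + d + c * (B * (B + norm u))"
    using l r v w by (simp add: inner_simps)
  then have "c * (v - (lz + rz)) \<le> c * (inner g (x - z) + inner u (x' - z) + e + d + c * (B * (B + norm u)))"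
    using c by (rule mult_left_mono)
  also have "\<dots> = c * (inner g (x - z) + inner u (x' - z)) + c * (e + d) + c\<^sup>2 * (B * (B + norm u))"
    by (simp add: algebra_simps power2_eq_square)
  also have "\<dots> = ((norm (x - z))\<^sup>2 - (norm (x' - z))\<^sup>2) / 2 + c * (e + d)
     + c\<^sup>2 * (((norm g)\<^sup>2 - (norm u)\<^sup>2) / 2 + B * (B + norm u))"
    unfolding eq by (simp add: algebra_simps)
  also have "c\<^sup>2 * (((norm g)\<^sup>2 - (norm u)\<^sup>2) / 2 + B * (B + norm u)) \<le> c\<^sup>2 * (2 * B\<^sup>2)"
  proof (intro mult_left_mono)
    have "(norm g)\<^sup>2 \<le> B\<^sup>2" using B by (intro power_mono) auto
    moreover have "0 \<le> (B - norm u)\<^sup>2" by simp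
    ultimately show "((norm g)\<^sup>2 - (norm u)\<^sup>2) / 2 + B * (B + norm u) \<le> 2 * B\<^sup>2"
      by (simp add: power2_eq_square field_simps)
  qed auto
  finally show ?thesis by (simp add: algebra_simps)
qed

lemma le_infdist_square:
  assumes X: "X \<noteq> {}" and c: "0 < c" and le: "\<And>z. z \<in> X \<Longrightarrow> m \<le> c * (dist x z)\<^sup>2"
  shows "m \<le> c * (infdist x X)\<^sup>2"
proof (cases "0 \<le> m")
  case True
  have "sqrt (m / c) \<le> dist x z" if "z \<in> X" for z
    using le[OF that] c by (intro real_le_lsqrt) (auto simp: field_simps)
  then have "sqrt (m / c) \<le> infdist x X"
    using X by (simp add: infdist_notempty cINF_greatest)
  then have "(sqrt (m / c))\<^sup>2 \<le> (infdist x X)\<^sup>2"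
    using True c by (intro power_mono) auto
  then show ?thesis
    using True c by (simp add: field_simps)
next
  case False
  then show ?thesis
    using c by (meson less_imp_le mult_nonneg_nonneg not_le order_trans zero_le_power2)
qed

theorem theorem3p1:
  fixes l :: "'a::{real_inner, complete_space} \<Rightarrow> real"
    and r f :: "'a \<Rightarrow> ereal"
    and \<alpha> \<theta> \<epsilon> B :: real
    and a e :: "nat \<Rightarrow> real"
    and x g :: "nat \<Rightarrow> 'a"
    and T :: nat
  assumes l: "proper_fun (\<lambda>z. ereal (l z))" "lsc_fun (\<lambda>z. ereal (l z))"
             "convex_fun (\<lambda>z. ereal (l z))"
    and r: "proper_fun r" "lsc_fun r" "convex_fun r"
    and f: "f = (\<lambda>z. ereal (l z) + r z)"
    and X_nonempty: "minimizers f \<noteq> {}"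
    and \<alpha>: "0 < \<alpha>"
    and \<theta>: "0 < \<theta>" "\<theta> < 1"
    and a: "\<And>t. 1 \<le> t \<Longrightarrow> a t = \<alpha> * real t powr (- \<theta>)"
    and \<epsilon>: "0 < \<epsilon>"
    and e: "\<And>t. 1 \<le> t \<Longrightarrow> 0 \<le> e t" "\<And>t. 1 \<le> t \<Longrightarrow> e t \<le> \<epsilon> * a t"
    and g: "\<And>t. 1 \<le> t \<Longrightarrow> g t \<in> eps_subdiff (e t) (\<lambda>z. ereal (l z)) (x t)"
    and x: "\<And>t. 1 \<le> t \<Longrightarrow>
              x (Suc t) = prox (\<lambda>z. ereal (a t) * r z) (x t - a t *\<^sub>R g t)"
    and B: "0 < B"
    and bound: "\<And>t v. 1 \<le> t \<Longrightarrow>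
                  v \<in> eps_subdiff (e t) (\<lambda>z. ereal (l z)) (x t) \<union> subdiff r (x t) \<Longrightarrow>
                  norm v \<le> B"
    and T: "3 < T"
  shows "f (x T) - (INF z. f z) \<le>
           ereal ((infdist (x 1) (minimizers f))\<^sup>2 / (2 * \<alpha>) * real T powr (\<theta> - 1)
             + \<alpha> * (5 * B\<^sup>2 + \<epsilon>) * c_const (2 * \<theta>)
               * ln (real T) ^ (if 2 * \<theta> \<le> 1 then 1 else 0)
               * real T powr (- min \<theta> (1 - \<theta>)))"
proof -
  define K where "K = 5 * B\<^sup>2 + \<epsilon>"
  have K: "0 < K" using B \<epsilon> by (simp add: K_def add_nonneg_pos)
  have a_pos: "0 < a t" if "1 \<le> t" for t
    using a[OF that] \<alpha> that by simp
  have a_anti: "a t \<le> a s" if "1 \<le> s" "s \<le> t" for s t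
    using a[of s] a[of t] that \<alpha> \<theta> by (simp add: powr_mono2')
  define \<rho> where "\<rho> t = real_of_ereal (r (x t))" for t
  define u where "u t = (1 / a t) *\<^sub>R (x t - a t *\<^sub>R g t - x (Suc t))" for t
  have \<rho>: "r (x (Suc t)) = ereal (\<rho> (Suc t))" if "1 \<le> t" for t
    using prox_scale_subgradient(1)[OF r a_pos[OF that] x[OF that]] r(1)
    unfolding \<rho>_def proper_fun_def by (cases "r (x (Suc t))") auto
  have u_sub: "u t \<in> subdiff r (x (Suc t))" if "1 \<le> t" for t
    unfolding u_def by (rule prox_scale_subgradient(2)[OF r a_pos[OF that] x[OF that]])
  have u: "\<rho> (Suc t) + inner (u t) (y - x (Suc t)) \<le> ry" if "1 \<le> t" "r y = ereal ry" for t y ry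
    using u_sub[OF that(1)] that(2) by (auto simp: eps_subdiff_def \<rho>[OF that(1)] dest!: spec[of _ y])
  have g_le: "l (x t) + inner (g t) (y - x t) - e t \<le> l y" if "1 \<le> t" for t y
    using g[OF that] by (auto simp: eps_subdiff_def dest!: spec[of _ y])
  have g_B: "norm (g t) \<le> B" if "1 \<le> t" for t
    using bound[OF that] g[OF that] by blast
  have u_B: "norm (u t) \<le> B" if "1 \<le> t" for t
    using bound[of "Suc t"] u_sub[OF that] by auto
  have x_Suc: "x (Suc t) = x t - a t *\<^sub>R (g t + u t)" if "1 \<le> t" for t
    using a_pos[OF that] by (simp add: u_def algebra_simps)

  define \<phi> where "\<phi> t = l (x t) + \<rho> t" for t
  \<comment> \<open>From the second step on, \<open>u (t - 1)\<close> is a subgradient of \<open>r\<close> at \<open>x t\<close>; it transfers \<open>r\<close> from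
    \<open>x (Suc t)\<close> back to \<open>x t\<close>.\<close>
  have step: "a t * (\<phi> t - (l y + ry))
      \<le> ((norm (x t - y))\<^sup>2 - (norm (x (Suc t) - y))\<^sup>2) / 2 + K * (a t)\<^sup>2"
    if t: "2 \<le> t" and y: "r y = ereal ry" for t y ry
  proof -
    obtain s where s: "t = Suc s" "1 \<le> s" using t by (cases t) auto
    have "\<phi> t \<le> l (x t) + \<rho> (Suc t) + inner (u s) (x t - x (Suc t)) + 0"
      using u[OF s(2) \<rho>[of t]] t unfolding \<phi>_def s(1) by (simp add: inner_diff_right)
    then have "a t * (\<phi> t - (l y + ry))
      \<le> ((norm (x t - y))\<^sup>2 - (norm (x (Suc t) - y))\<^sup>2) / 2 + 2 * B\<^sup>2 * (a t)\<^sup>2 + a t * (e t + 0)"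
      using t s(2) a_pos[of t] y
      by (intro forward_backward_step[OF x_Suc _ g_le u _ g_B u_B u_B]) auto
    moreover have "a t * e t \<le> a t * (\<epsilon> * a t)"
      using e(2)[of t] a_pos[of t] t by (intro mult_left_mono) auto
    moreover have "0 \<le> B\<^sup>2 * (a t)\<^sup>2" by simp
    ultimately show ?thesis by (simp add: K_def algebra_simps power2_eq_square)
  qed
  \<comment> \<open>The point \<open>x 1\<close> may lie outside the domain of \<open>r\<close>, so the first step is measured by
    the value at \<open>x 2\<close>: here \<open>g 2\<close> transfers \<open>l\<close> from \<open>x 1\<close> forward to \<open>x 2\<close>, at the price of
    the additional error \<open>e 2\<close> and of a doubled constant.\<close>
  have first_step: "a 1 * (\<phi> 2 - (l y + ry))
      \<le> ((norm (x 1 - y))\<^sup>2 - (norm (x 2 - y))\<^sup>2) / 2 + 2 * K * (a 1)\<^sup>2"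
    if y: "r y = ereal ry" for y ry
  proof -
    have "\<phi> 2 \<le> l (x 1) + \<rho> (Suc 1) + inner (- g 2) (x 1 - x (Suc 1)) + e 2"
      using g_le[of 2 "x 1"] by (simp add: \<phi>_def numeral_2_eq_2)
    then have "a 1 * (\<phi> 2 - (l y + ry))
      \<le> ((norm (x 1 - y))\<^sup>2 - (norm (x (Suc 1) - y))\<^sup>2) / 2 + 2 * B\<^sup>2 * (a 1)\<^sup>2 + a 1 * (e 1 + e 2)"
      using a_pos[of 1] y g_B[of 2]
      by (intro forward_backward_step[OF x_Suc _ g_le u _ g_B u_B, where w = "- g 2"]) auto
    moreover have "a 1 * (e 1 + e 2) \<le> a 1 * (2 * (\<epsilon> * a 1))"
    proof (intro mult_left_mono)
      have "\<epsilon> * a 2 \<le> \<epsilon> * a 1" using a_anti[of 1 2] \<epsilon> by (intro mult_left_mono) auto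
      then show "e 1 + e 2 \<le> 2 * (\<epsilon> * a 1)" using e(2)[of 1] e(2)[of 2] by simp
    qed (use a_pos[of 1] in simp)
    moreover have "0 \<le> B\<^sup>2 * (a 1)\<^sup>2" by simp
    ultimately show ?thesis by (simp add: K_def algebra_simps power2_eq_square numeral_2_eq_2)
  qed

  obtain fs where fs: "(INF z. f z) = ereal fs"
    and fs_min: "\<And>z. z \<in> minimizers f \<Longrightarrow> \<exists>rz. r z = ereal rz \<and> fs = l z + rz"
  proof -
    obtain z where z: "f z = (INF z. f z)" using X_nonempty by (auto simp: minimizers_def)
    obtain y where y: "r y \<noteq> \<infinity>" using r(1) by (auto simp: proper_fun_def)
    have "f z \<le> f y" unfolding z by (rule INF_lower) simp
    then have "f z \<noteq> \<infinity>" "f z \<noteq> -\<infinity>"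
      using y r(1) by (auto simp: f proper_fun_def)
    then obtain fs where "(INF z. f z) = ereal fs" using z by (metis ereal_cases)
    moreover from this have "\<exists>rz. r z = ereal rz \<and> fs = l z + rz" if "z \<in> minimizers f" for z
      using that by (cases "r z") (auto simp: minimizers_def f)
    ultimately show ?thesis using that by blast
  qed
  have \<phi>_f: "f (x t) = ereal (\<phi> t)" if "2 \<le> t" for t
    using that \<rho>[of "t - 1"] by (simp add: f \<phi>_def)
  have \<phi>_ge: "fs \<le> \<phi> t" if "2 \<le> t" for t
    using INF_lower[of "x t" UNIV f] by (simp add: fs \<phi>_f[OF that])

  \<comment> \<open>The sequence of values is \<open>\<phi> (max 2 t) - fs\<close>, which repeats the value at \<open>x 2\<close> for \<open>t = 1\<close>.
    For \<open>j = 1\<close> the first term of the sum is thus at most zero, and the comparison with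
    \<open>x 2\<close> starts at \<open>t = 2\<close>, with distance zero; this is why \<open>P 1\<close> is set to zero.\<close>
  have restart: "(\<Sum>t=j..T. a t * ((\<phi> (max 2 t) - fs) - (\<phi> (max 2 j) - fs)) - K * (a t)\<^sup>2) \<le> 0"
    if j: "1 \<le> j" "j < T" for j
  proof -
    define i where "i = max 2 j"
    define P where "P t = (if t = 1 then 0 else (norm (x t - x i))\<^sup>2 / 2)" for t
    have ri: "r (x i) = ereal (\<rho> i)" using \<rho>[of "i - 1"] by (simp add: i_def)
    have "(\<Sum>t=j..T. a t * ((\<phi> (max 2 t) - fs) - (\<phi> (max 2 j) - fs)) - K * (a t)\<^sup>2) \<le> P j"
    proof (rule sum_le_telescope)
      fix t assume t: "j \<le> t" "t \<le> T"
      show "a t * ((\<phi> (max 2 t) - fs) - (\<phi> (max 2 j) - fs)) - K * (a t)\<^sup>2 \<le> P t - P (Suc t)"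
      proof (cases "t = 1")
        case True
        then show ?thesis using j t K by (simp add: P_def i_def numeral_2_eq_2)
      next
        case False
        then have "2 \<le> t" using j t by simp
        moreover have "\<phi> (max 2 j) = l (x i) + \<rho> i" by (simp add: \<phi>_def i_def)
        ultimately show ?thesis using step[OF _ ri, of t] False
          by (simp add: P_def max_absorb2 diff_divide_distrib algebra_simps)
      qed
    qed (use j in \<open>auto simp: P_def\<close>)
    also have "P j = 0" using j by (auto simp: P_def i_def max_def)
    finally show ?thesis .
  qed

  define W where "W = 1 / T + real T powr (-(2 * \<theta>))
     + (\<Sum>t=1..<T. real t powr (-(2 * \<theta>)) / real (T - t))"
  have asq: "(a t)\<^sup>2 = \<alpha>\<^sup>2 * real t powr (-(2 * \<theta>))" if "1 \<le> t" for t
    using a[OF that] that by (simp add: power_mult_distrib powr_power)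
  have per_minimizer: "\<phi> T - fs - K * \<alpha> * (real T powr \<theta> * W) \<le> real T powr (\<theta> - 1) / (2 * \<alpha>) * (dist (x 1) z)\<^sup>2"
    if z: "z \<in> minimizers f" for z
  proof -
    obtain rz where rz: "r z = ereal rz" "fs = l z + rz" using fs_min[OF z] by blast
    \<comment> \<open>The surplus of the first step over \<open>K * (a 1)\<^sup>2\<close> is charged to the potential; after division by
      \<open>T\<close> it is the summand \<open>1 / T\<close> of \<open>W\<close>.\<close>
    define P where "P t = (norm (x t - z))\<^sup>2 / 2 + (if t = 1 then K * (a 1)\<^sup>2 else 0)" for t
    have start: "(\<Sum>t=1..T. a t * (\<phi> (max 2 t) - fs) - K * (a t)\<^sup>2) \<le> P 1"
    proof (rule sum_le_telescope)
      fix t assume t: "1 \<le> t" "t \<le> T"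
      show "a t * (\<phi> (max 2 t) - fs) - K * (a t)\<^sup>2 \<le> P t - P (Suc t)"
      proof (cases "t = 1")
        case True
        then show ?thesis using first_step[OF rz(1)]
          by (simp add: P_def rz(2) numeral_2_eq_2 diff_divide_distrib)
      next
        case False
        then show ?thesis using step[OF _ rz(1), of t] t
          by (simp add: P_def rz(2) max_def diff_divide_distrib)
      qed
    qed (use K in \<open>auto simp: P_def\<close>)
    have "a T * (\<phi> (max 2 T) - fs) \<le> P 1 / T + K * (a T)\<^sup>2 + (\<Sum>t=1..<T. K * (a t)\<^sup>2 / real (T - t))"
      by (rule last_iterate_bound[where u = "\<lambda>t. \<phi> (max 2 t) - fs", OF _ _ a_anti start restart])
        (use T \<phi>_ge in auto)
    also have "(\<Sum>t=1..<T. K * (a t)\<^sup>2 / real (T - t))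
        = K * \<alpha>\<^sup>2 * (\<Sum>t=1..<T. real t powr (-(2 * \<theta>)) / real (T - t))"
      unfolding sum_distrib_left by (intro sum.cong refl) (simp add: asq)
    also have "P 1 / T + K * (a T)\<^sup>2 + K * \<alpha>\<^sup>2 * (\<Sum>t=1..<T. real t powr (-(2 * \<theta>)) / real (T - t))
       = (dist (x 1) z)\<^sup>2 / (2 * T) + K * \<alpha>\<^sup>2 * W"
      using T by (simp add: P_def W_def asq dist_norm algebra_simps add_divide_distrib)
    finally have "real T powr \<theta> / \<alpha> * (a T * (\<phi> T - fs))
        \<le> real T powr \<theta> / \<alpha> * ((dist (x 1) z)\<^sup>2 / (2 * T) + K * \<alpha>\<^sup>2 * W)"
      using T \<alpha> by (intro mult_left_mono) auto
    moreover have "real T powr \<theta> / \<alpha> * (a T * (\<phi> T - fs)) = \<phi> T - fs"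
      using T \<alpha> by (simp add: a powr_minus)
    moreover have "real T powr \<theta> / \<alpha> * ((dist (x 1) z)\<^sup>2 / (2 * T) + K * \<alpha>\<^sup>2 * W)
       = real T powr (\<theta> - 1) / (2 * \<alpha>) * (dist (x 1) z)\<^sup>2 + K * \<alpha> * (real T powr \<theta> * W)"
      using T \<alpha> by (simp add: powr_diff field_simps power2_eq_square)
    ultimately show ?thesis by linarith
  qed
  define C where "C = c_const (2 * \<theta>) * ln T ^ (if 2 * \<theta> \<le> 1 then 1 else 0)
     * real T powr (- min \<theta> (1 - \<theta>))"
  have "\<phi> T - fs - K * \<alpha> * (real T powr \<theta> * W)
      \<le> real T powr (\<theta> - 1) / (2 * \<alpha>) * (infdist (x 1) (minimizers f))\<^sup>2"
    using X_nonempty T \<alpha> by (intro le_infdist_square per_minimizer) auto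
  moreover have "K * \<alpha> * (real T powr \<theta> * W) \<le> K * \<alpha> * C"
    unfolding W_def C_def using K \<alpha> \<theta> T by (intro mult_left_mono last_iterate_rate) auto
  ultimately have "\<phi> T - fs
      \<le> real T powr (\<theta> - 1) / (2 * \<alpha>) * (infdist (x 1) (minimizers f))\<^sup>2 + K * \<alpha> * C"
    by linarith
  also have "\<dots> = (infdist (x 1) (minimizers f))\<^sup>2 / (2 * \<alpha>) * real T powr (\<theta> - 1)
     + \<alpha> * (5 * B\<^sup>2 + \<epsilon>) * c_const (2 * \<theta>) * ln (real T) ^ (if 2 * \<theta> \<le> 1 then 1 else 0)
       * real T powr (- min \<theta> (1 - \<theta>))"
    by (simp only: K_def C_def mult_ac times_divide_eq_left times_divide_eq_right)
  finally show ?thesis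
    using T by (simp only: fs \<phi>_f[of T] ereal_minus ereal_less_eq)
qed

end
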